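(* Let $X$ be a finite indecomposable quandle. If the action of $N_X$ on $X$ is regular (i.e. transitive with trivial point stabilizers), then $H^2(X,\mathbb C^\times)\simeq\mathbb C^\times$.
   Context: A rack is a non-empty set $X$ with a binary operation $\triangleright$ such that every map $\varphi_x\colon y\mapsto x\triangleright y$ is bijective and $x\triangleright(y\triangleright z)=(x\triangleright y)\triangleright(x\triangleright z)$ for all $x,y,z$. A quandle is a rack with $x\triangleright x=x$ for all $x$. It is indecomposable if the group $\langle\varphi_x:x\in X\rangle\le \mathbb S_X$ acts transitively on $X$. The enveloping group is $G_X=\langle x\in X: xy=(x\triangleright y)x\rangle$; it acts on $X$ with the generator $x$ acting by $\varphi_x$. Put $N_X=[G_X,G_X]$. Rack cohomology $H^2(X,\mathbb C^\times)$ (trivial coefficients): a 2-cocycle is a map $q\colon X\times X\to \mathbb C^\times$ with $q_{x\triangleright y,x\triangleright z}\,q_{x,z}=q_{x,y\triangleright z}\,q_{y,z}$ for all $x,y,z$; two cocycles $q,q'$ are equivalent if there is $\gamma\colon X\to \mathbb C^\times$ with $q'_{x,y}=q_{x,y}\gamma(x\triangleright y)\gamma(y)^{-1}$ for all $x,y$; $H^2(X,\mathbb C^\times)$ is the group of equivalence classes. *)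

theory Defs
  imports "HOL-Algebra.Group_Action" "HOL-Algebra.Generated_Groups" Complex_Main
begin

section \<open>Racks and quandles\<close>

locale rack =
  fixes X :: "'a set" and rop :: "'a \<Rightarrow> 'a \<Rightarrow> 'a" (infixr "\<triangleright>" 65)
  assumes nonempty: "X \<noteq> {}"
    and bij: "x \<in> X \<Longrightarrow> bij_betw (\<lambda>y. x \<triangleright> y) X X"
    and self_distrib: "\<lbrakk>x \<in> X; y \<in> X; z \<in> X\<rbrakk> \<Longrightarrow> x \<triangleright> (y \<triangleright> z) = (x \<triangleright> y) \<triangleright> (x \<triangleright> z)"

locale quandle = rack +
  assumes idem: "x \<in> X \<Longrightarrow> x \<triangleright> x = x"

text \<open>The map \<open>\<phi>\<^sub>x\<close>, as an element of the symmetric group \<^term>\<open>BijGroup X\<close>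
  (whose elements are extensional functions).\<close>

definition rack_map :: "'a set \<Rightarrow> ('a \<Rightarrow> 'a \<Rightarrow> 'a) \<Rightarrow> 'a \<Rightarrow> 'a \<Rightarrow> 'a" where
  "rack_map X rop x = (\<lambda>y\<in>X. rop x y)"

definition inner_group :: "'a set \<Rightarrow> ('a \<Rightarrow> 'a \<Rightarrow> 'a) \<Rightarrow> ('a \<Rightarrow> 'a) monoid" where
  "inner_group X rop = (BijGroup X)\<lparr>carrier := generate (BijGroup X) (rack_map X rop ` X)\<rparr>"

definition indecomposable :: "'a set \<Rightarrow> ('a \<Rightarrow> 'a \<Rightarrow> 'a) \<Rightarrow> bool" where
  "indecomposable X rop \<longleftrightarrow> transitive_action (inner_group X rop) X (\<lambda>f. f)"

definition regular_action :: "('g, 'm) monoid_scheme \<Rightarrow> 'a set \<Rightarrow> ('g \<Rightarrow> 'a \<Rightarrow> 'a) \<Rightarrow> bool" where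
  "regular_action G E \<phi> \<longleftrightarrow>
     transitive_action G E \<phi> \<and> (\<forall>x\<in>E. stabilizer G \<phi> x = {\<one>\<^bsub>G\<^esub>})"

lemma (in rack) closed: "x \<in> X \<Longrightarrow> y \<in> X \<Longrightarrow> x \<triangleright> y \<in> X"
  using bij by (auto simp: bij_betw_def)

lemma (in rack) rack_map_Bij: "x \<in> X \<Longrightarrow> rack_map X (\<triangleright>) x \<in> carrier (BijGroup X)"
  using bij by (auto simp: rack_map_def BijGroup_def Bij_def cong: bij_betw_cong)

lemma (in rack) inner_group_action: "group_action (inner_group X (\<triangleright>)) X (\<lambda>f. f)"
proof -
  interpret B: group "BijGroup X" by (rule group_BijGroup)
  have sub: "subgroup (generate (BijGroup X) (rack_map X (\<triangleright>) ` X)) (BijGroup X)"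
    using rack_map_Bij by (intro B.generate_is_subgroup) blast
  have "group (inner_group X (\<triangleright>))"
    unfolding inner_group_def by (rule B.subgroup_imp_group[OF sub])
  moreover have "(\<lambda>f. f) \<in> hom (inner_group X (\<triangleright>)) (BijGroup X)"
    using subgroup.subset[OF sub] by (auto simp: hom_def inner_group_def)
  ultimately show ?thesis
    by (simp add: group_action_def group_hom_def group_hom_axioms_def group_BijGroup)
qed


section \<open>Groups given by generators and relations\<close>

text \<open>A word is a list of letters \<open>(s, b)\<close>: the letter \<open>(s, True)\<close> stands for the
  generator \<open>s\<close> and \<open>(s, False)\<close> for its inverse. A relation \<open>(u, v)\<close> means \<open>u = v\<close>.\<close>

type_synonym 's word = "('s \<times> bool) list"

inductive word_eq :: "'s set \<Rightarrow> ('s word \<times> 's word) set \<Rightarrow> 's word \<Rightarrow> 's word \<Rightarrow> bool"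
  for S R where
  refl: "w \<in> lists (S \<times> UNIV) \<Longrightarrow> word_eq S R w w"
| sym: "word_eq S R u v \<Longrightarrow> word_eq S R v u"
| trans: "word_eq S R u v \<Longrightarrow> word_eq S R v w \<Longrightarrow> word_eq S R u w"
| append: "word_eq S R u u' \<Longrightarrow> word_eq S R v v' \<Longrightarrow> word_eq S R (u @ v) (u' @ v')"
| cancel: "s \<in> S \<Longrightarrow> word_eq S R [(s, b), (s, \<not> b)] []"
| rel: "(u, v) \<in> R \<Longrightarrow> u \<in> lists (S \<times> UNIV) \<Longrightarrow> v \<in> lists (S \<times> UNIV) \<Longrightarrow> word_eq S R u v"

definition word_rel :: "'s set \<Rightarrow> ('s word \<times> 's word) set \<Rightarrow> ('s word \<times> 's word) set" where
  "word_rel S R = {(u, v). word_eq S R u v}"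

definition presented_group :: "'s set \<Rightarrow> ('s word \<times> 's word) set \<Rightarrow> 's word set monoid" where
  "presented_group S R =
     \<lparr>carrier = lists (S \<times> UNIV) // word_rel S R,
      mult = (\<lambda>A B. \<Union>u\<in>A. \<Union>v\<in>B. word_rel S R `` {u @ v}),
      one = word_rel S R `` {[]}\<rparr>"

text \<open>The homomorphism induced by a map \<open>f\<close> from the generators to a group \<open>H\<close>
  under which the relations hold.\<close>

definition eval_word :: "('h, 'm) monoid_scheme \<Rightarrow> ('s \<Rightarrow> 'h) \<Rightarrow> 's word \<Rightarrow> 'h" where
  "eval_word H f w =
     foldr (\<lambda>(s, b) h. (if b then f s else inv\<^bsub>H\<^esub> (f s)) \<otimes>\<^bsub>H\<^esub> h) w \<one>\<^bsub>H\<^esub>"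

definition induced_hom :: "('h, 'm) monoid_scheme \<Rightarrow> ('s \<Rightarrow> 'h) \<Rightarrow> 's word set \<Rightarrow> 'h" where
  "induced_hom H f A = the_elem (eval_word H f ` A)"

lemma word_eq_lists:
  "word_eq S R u v \<Longrightarrow> u \<in> lists (S \<times> UNIV) \<and> v \<in> lists (S \<times> UNIV)"
  by (induction rule: word_eq.induct) auto

lemma equiv_word_rel: "equiv (lists (S \<times> UNIV)) (word_rel S R)"
proof (rule equivI)
  show "word_rel S R \<subseteq> lists (S \<times> UNIV) \<times> lists (S \<times> UNIV)"
    using word_eq_lists unfolding word_rel_def by blast
  show "refl_on (lists (S \<times> UNIV)) (word_rel S R)"
    using word_eq_lists unfolding word_rel_def refl_on_def by (blast intro: word_eq.refl)
  show "sym (word_rel S R)"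
    unfolding word_rel_def sym_def by (blast intro: word_eq.sym)
  show "trans (word_rel S R)"
    unfolding word_rel_def trans_def by (blast intro: word_eq.trans)
qed

lemma presented_mult:
  assumes "u \<in> lists (S \<times> UNIV)" "v \<in> lists (S \<times> UNIV)"
  shows "word_rel S R `` {u} \<otimes>\<^bsub>presented_group S R\<^esub> word_rel S R `` {v}
           = word_rel S R `` {u @ v}"
proof -
  have "congruent2 (word_rel S R) (word_rel S R) (\<lambda>u v. word_rel S R `` {u @ v})"
    by (intro congruent2I' equiv_class_eq[OF equiv_word_rel])
       (auto simp: word_rel_def intro: word_eq.append)
  then show ?thesis
    using assms UN_equiv_class2[OF equiv_word_rel equiv_word_rel]
    by (simp add: presented_group_def)
qed

lemma presented_carrierE:
  assumes "A \<in> carrier (presented_group S R)"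
  obtains u where "u \<in> lists (S \<times> UNIV)" "A = word_rel S R `` {u}"
  using assms that by (auto simp: presented_group_def quotient_def)

lemma presented_carrierI:
  "u \<in> lists (S \<times> UNIV) \<Longrightarrow> word_rel S R `` {u} \<in> carrier (presented_group S R)"
  by (simp add: presented_group_def quotientI)

lemma word_left_inverse:
  assumes "w \<in> lists (S \<times> UNIV)"
  shows "\<exists>w'\<in>lists (S \<times> UNIV). word_eq S R (w' @ w) []"
  using assms
proof (induction w)
  case Nil
  show ?case by (auto intro: bexI[of _ "[]"] word_eq.refl)
next
  case (Cons l w)
  obtain s b where l: "l = (s, b)" by (cases l)
  from Cons obtain w' where w': "w' \<in> lists (S \<times> UNIV)" "word_eq S R (w' @ w) []"
    by auto
  have s: "s \<in> S" and w: "w \<in> lists (S \<times> UNIV)" using Cons.hyps l by auto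
  have "word_eq S R ([(s, \<not> b), (s, b)] @ w) ([] @ w)"
    using word_eq.append[OF word_eq.cancel[OF s, of R "\<not> b"] word_eq.refl[OF w]] by simp
  from word_eq.append[OF word_eq.refl[OF w'(1)] this]
  have "word_eq S R ((w' @ [(s, \<not> b)]) @ l # w) (w' @ w)" by (simp add: l)
  then have "word_eq S R ((w' @ [(s, \<not> b)]) @ l # w) []"
    using w'(2) word_eq.trans by blast
  then show ?case using w'(1) s by (intro bexI[of _ "w' @ [(s, \<not> b)]"]) auto
qed

lemma group_presented_group: "group (presented_group S R)"
proof (rule groupI)
  let ?G = "presented_group S R"
  have nil: "[] \<in> lists (S \<times> UNIV)" by simp
  have one: "\<one>\<^bsub>?G\<^esub> = word_rel S R `` {[]}" by (simp add: presented_group_def)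
  show "\<one>\<^bsub>?G\<^esub> \<in> carrier ?G" unfolding one by (rule presented_carrierI[OF nil])
  show "A \<otimes>\<^bsub>?G\<^esub> B \<in> carrier ?G" if "A \<in> carrier ?G" "B \<in> carrier ?G" for A B
    using that by (elim presented_carrierE) (auto simp: presented_mult intro!: presented_carrierI)
  show "A \<otimes>\<^bsub>?G\<^esub> B \<otimes>\<^bsub>?G\<^esub> C = A \<otimes>\<^bsub>?G\<^esub> (B \<otimes>\<^bsub>?G\<^esub> C)"
    if "A \<in> carrier ?G" "B \<in> carrier ?G" "C \<in> carrier ?G" for A B C
    using that by (elim presented_carrierE) (simp add: presented_mult)
  show "\<one>\<^bsub>?G\<^esub> \<otimes>\<^bsub>?G\<^esub> A = A" if "A \<in> carrier ?G" for A
    using that by (elim presented_carrierE) (simp add: one presented_mult)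
  show "\<exists>B\<in>carrier ?G. B \<otimes>\<^bsub>?G\<^esub> A = \<one>\<^bsub>?G\<^esub>" if A: "A \<in> carrier ?G" for A
  proof -
    from A obtain u where u: "u \<in> lists (S \<times> UNIV)" "A = word_rel S R `` {u}"
      by (rule presented_carrierE)
    from word_left_inverse[OF u(1), of R] obtain v
      where v: "v \<in> lists (S \<times> UNIV)" "word_eq S R (v @ u) []" by blast
    have "word_rel S R `` {v @ u} = word_rel S R `` {[]}"
      using v(2) by (intro equiv_class_eq[OF equiv_word_rel]) (simp add: word_rel_def)
    then show ?thesis
      using u v by (intro bexI[of _ "word_rel S R `` {v}"])
        (simp_all add: one presented_mult presented_carrierI)
  qed
qed

context
  fixes H :: "('h, 'm) monoid_scheme" and f :: "'s \<Rightarrow> 'h" and S :: "'s set"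
  assumes H: "group H" and f: "f \<in> S \<rightarrow> carrier H"
begin

interpretation H: group H by (rule H)

lemma eval_word_closed: "w \<in> lists (S \<times> UNIV) \<Longrightarrow> eval_word H f w \<in> carrier H"
  using f by (induction w) (auto simp: eval_word_def Pi_iff)

lemma eval_word_append:
  "u \<in> lists (S \<times> UNIV) \<Longrightarrow> v \<in> lists (S \<times> UNIV) \<Longrightarrow>
     eval_word H f (u @ v) = eval_word H f u \<otimes>\<^bsub>H\<^esub> eval_word H f v"
proof (induction u)
  case Nil
  then show ?case using eval_word_closed[of v] by (simp add: eval_word_def)
next
  case (Cons l u)
  obtain s b where l: "l = (s, b)" by (cases l)
  have u: "u \<in> lists (S \<times> UNIV)" and s: "f s \<in> carrier H" using Cons l f by auto
  have Cons_eq: "eval_word H f (l # w)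
      = (if b then f s else inv\<^bsub>H\<^esub> (f s)) \<otimes>\<^bsub>H\<^esub> eval_word H f w" for w
    by (simp add: eval_word_def l)
  show ?case
    using Cons u s eval_word_closed[OF u] eval_word_closed[OF Cons.prems(2)]
    by (simp add: Cons_eq H.m_assoc)
qed

lemma eval_word_cong:
  assumes R: "\<forall>(u, v)\<in>R. eval_word H f u = eval_word H f v"
  shows "word_eq S R u v \<Longrightarrow> eval_word H f u = eval_word H f v"
proof (induction rule: word_eq.induct)
  case (append u u' v v')
  then show ?case using word_eq_lists[OF append(1)] word_eq_lists[OF append(2)]
    by (simp add: eval_word_append)
next
  case (cancel s b)
  then have "f s \<in> carrier H" using f by auto
  then show ?case by (simp add: eval_word_def)
next
  case (rel u v)
  then show ?case using R by blast
qed simp_all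

lemma induced_hom_class:
  assumes R: "\<forall>(u, v)\<in>R. eval_word H f u = eval_word H f v"
    and w: "w \<in> lists (S \<times> UNIV)"
  shows "induced_hom H f (word_rel S R `` {w}) = eval_word H f w"
proof -
  have "w \<in> word_rel S R `` {w}" using w by (simp add: word_rel_def word_eq.refl)
  moreover have "eval_word H f v = eval_word H f w" if "v \<in> word_rel S R `` {w}" for v
    using that eval_word_cong[OF R, of w v] by (simp add: word_rel_def)
  ultimately have "eval_word H f ` (word_rel S R `` {w}) = {eval_word H f w}" by blast
  then show ?thesis by (simp add: induced_hom_def)
qed

lemma induced_hom_hom:
  assumes R: "\<forall>(u, v)\<in>R. eval_word H f u = eval_word H f v"
  shows "induced_hom H f \<in> hom (presented_group S R) H"
proof (rule homI)
  fix A B assume A: "A \<in> carrier (presented_group S R)" and B: "B \<in> carrier (presented_group S R)"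
  from A show "induced_hom H f A \<in> carrier H"
    by (elim presented_carrierE) (simp add: induced_hom_class[OF R] eval_word_closed)
  from A B show "induced_hom H f (A \<otimes>\<^bsub>presented_group S R\<^esub> B)
      = induced_hom H f A \<otimes>\<^bsub>H\<^esub> induced_hom H f B"
    by (elim presented_carrierE)
      (simp add: induced_hom_class[OF R] presented_mult eval_word_append)
qed

end


section \<open>The enveloping group and its action\<close>

definition enveloping_relations :: "'a set \<Rightarrow> ('a \<Rightarrow> 'a \<Rightarrow> 'a) \<Rightarrow> ('a word \<times> 'a word) set" where
  "enveloping_relations X rop =
     {([(x, True), (y, True)], [(rop x y, True), (x, True)]) | x y. x \<in> X \<and> y \<in> X}"

definition enveloping_group :: "'a set \<Rightarrow> ('a \<Rightarrow> 'a \<Rightarrow> 'a) \<Rightarrow> 'a word set monoid" where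
  "enveloping_group X rop = presented_group X (enveloping_relations X rop)"

definition enveloping_action ::
    "'a set \<Rightarrow> ('a \<Rightarrow> 'a \<Rightarrow> 'a) \<Rightarrow> 'a word set \<Rightarrow> 'a \<Rightarrow> 'a" where
  "enveloping_action X rop = induced_hom (BijGroup X) (rack_map X rop)"

definition enveloping_derived :: "'a set \<Rightarrow> ('a \<Rightarrow> 'a \<Rightarrow> 'a) \<Rightarrow> 'a word set monoid" where
  "enveloping_derived X rop =
     (enveloping_group X rop)
       \<lparr>carrier := derived (enveloping_group X rop) (carrier (enveloping_group X rop))\<rparr>"

context rack
begin

lemma rack_map_relation:
  "\<forall>(u, v)\<in>enveloping_relations X (\<triangleright>).
     eval_word (BijGroup X) (rack_map X (\<triangleright>)) u = eval_word (BijGroup X) (rack_map X (\<triangleright>)) v"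
proof clarify
  fix u v assume uv: "(u, v) \<in> enveloping_relations X (\<triangleright>)"
  interpret B: group "BijGroup X" by (rule group_BijGroup)
  from uv obtain x y where xy: "x \<in> X" "y \<in> X"
    and u: "u = [(x, True), (y, True)]" and v: "v = [(x \<triangleright> y, True), (x, True)]"
    by (auto simp: enveloping_relations_def)
  have "rack_map X (\<triangleright>) x \<otimes>\<^bsub>BijGroup X\<^esub> rack_map X (\<triangleright>) y
      = rack_map X (\<triangleright>) (x \<triangleright> y) \<otimes>\<^bsub>BijGroup X\<^esub> rack_map X (\<triangleright>) x"
    using xy rack_map_Bij[OF xy(1)] rack_map_Bij[OF xy(2)] rack_map_Bij[OF closed[OF xy]]
    by (simp add: BijGroup_def)
       (auto simp: compose_def rack_map_def closed self_distrib[symmetric] intro!: restrict_ext)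
  then show "eval_word (BijGroup X) (rack_map X (\<triangleright>)) u
      = eval_word (BijGroup X) (rack_map X (\<triangleright>)) v"
    using rack_map_Bij xy closed by (simp add: u v eval_word_def)
qed

lemma enveloping_action_generator:
  assumes "x \<in> X"
  shows "enveloping_action X (\<triangleright>) (word_rel X (enveloping_relations X (\<triangleright>)) `` {[(x, True)]})
           = rack_map X (\<triangleright>) x"
proof -
  interpret B: group "BijGroup X" by (rule group_BijGroup)
  have "enveloping_action X (\<triangleright>) (word_rel X (enveloping_relations X (\<triangleright>)) `` {[(x, True)]})
      = eval_word (BijGroup X) (rack_map X (\<triangleright>)) [(x, True)]"
    unfolding enveloping_action_def using assms
    by (intro induced_hom_class[OF group_BijGroup _ rack_map_relation])
       (auto intro: rack_map_Bij)
  then show ?thesis using rack_map_Bij[OF assms] by (simp add: eval_word_def)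
qed

lemma enveloping_group_action:
  "group_action (enveloping_group X (\<triangleright>)) X (enveloping_action X (\<triangleright>))"
  unfolding group_action_def group_hom_def group_hom_axioms_def
    enveloping_group_def enveloping_action_def
  by (intro conjI group_presented_group group_BijGroup
        induced_hom_hom[OF _ _ rack_map_relation]) (auto intro: rack_map_Bij)

lemma enveloping_derived_action:
  "group_action (enveloping_derived X (\<triangleright>)) X (enveloping_action X (\<triangleright>))"
proof -
  interpret A: group_action "enveloping_group X (\<triangleright>)" X "enveloping_action X (\<triangleright>)"
    by (rule enveloping_group_action)
  interpret A: group_hom "enveloping_group X (\<triangleright>)" "BijGroup X" "enveloping_action X (\<triangleright>)"
    by (rule A.group_hom)
  have sub: "subgroup (derived (enveloping_group X (\<triangleright>)) (carrier (enveloping_group X (\<triangleright>))))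
      (enveloping_group X (\<triangleright>))"
    by (rule group.derived_is_subgroup[OF A.G.is_group subset_refl])
  have "group (enveloping_derived X (\<triangleright>))"
    unfolding enveloping_derived_def by (rule group.subgroup_imp_group[OF A.G.is_group sub])
  moreover have "enveloping_action X (\<triangleright>) \<in> hom (enveloping_derived X (\<triangleright>)) (BijGroup X)"
    using A.homh subgroup.subset[OF sub]
    by (auto simp: hom_def enveloping_derived_def subset_iff)
  ultimately show ?thesis
    by (simp add: group_action_def group_hom_def group_hom_axioms_def group_BijGroup)
qed

end


section \<open>Second rack cohomology with coefficients in the multiplicative group of the complex numbers\<close>

definition complex_units :: "complex monoid" where
  "complex_units = \<lparr>carrier = - {0}, mult = (*), one = 1\<rparr>"

definition rack_cocycles :: "'a set \<Rightarrow> ('a \<Rightarrow> 'a \<Rightarrow> 'a) \<Rightarrow> ('a \<times> 'a \<Rightarrow> complex) monoid" where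
  "rack_cocycles X rop =
     \<lparr>carrier = {q \<in> X \<times> X \<rightarrow>\<^sub>E - {0}.
        \<forall>x\<in>X. \<forall>y\<in>X. \<forall>z\<in>X.
          q (rop x y, rop x z) * q (x, z) = q (x, rop y z) * q (y, z)},
      mult = (\<lambda>p q. \<lambda>z\<in>X \<times> X. p z * q z),
      one = (\<lambda>z\<in>X \<times> X. 1)\<rparr>"

definition cocycle_equiv ::
    "'a set \<Rightarrow> ('a \<Rightarrow> 'a \<Rightarrow> 'a) \<Rightarrow> (('a \<times> 'a \<Rightarrow> complex) \<times> ('a \<times> 'a \<Rightarrow> complex)) set" where
  "cocycle_equiv X rop =
     {(q, q'). q \<in> carrier (rack_cocycles X rop) \<and> q' \<in> carrier (rack_cocycles X rop) \<and>
        (\<exists>\<gamma>\<in>X \<rightarrow> - {0}. \<forall>x\<in>X. \<forall>y\<in>X. q' (x, y) = q (x, y) * \<gamma> (rop x y) * inverse (\<gamma> y))}"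

text \<open>The elementwise product \<^const>\<open>set_mult\<close> of two classes is again a class;
  see \<open>rack_H2_eq_Mod\<close> below.\<close>

definition rack_H2 :: "'a set \<Rightarrow> ('a \<Rightarrow> 'a \<Rightarrow> 'a) \<Rightarrow> ('a \<times> 'a \<Rightarrow> complex) set monoid" where
  "rack_H2 X rop =
     \<lparr>carrier = carrier (rack_cocycles X rop) // cocycle_equiv X rop,
      mult = set_mult (rack_cocycles X rop),
      one = cocycle_equiv X rop `` {\<one>\<^bsub>rack_cocycles X rop\<^esub>}\<rparr>"

lemma complex_units_comm_group: "comm_group complex_units"
proof (rule comm_groupI)
  show "\<exists>y\<in>carrier complex_units. y \<otimes>\<^bsub>complex_units\<^esub> x = \<one>\<^bsub>complex_units\<^esub>"
    if "x \<in> carrier complex_units" for x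
    using that by (intro bexI[of _ "inverse x"]) (auto simp: complex_units_def)
qed (auto simp: complex_units_def)

context rack
begin

lemma cocycle_mult_eq:
  "p \<otimes>\<^bsub>rack_cocycles X (\<triangleright>)\<^esub> q = (\<lambda>z\<in>X \<times> X. p z * q z)"
  by (simp add: rack_cocycles_def)

lemma rack_cocycles_comm_group: "comm_group (rack_cocycles X (\<triangleright>))"
proof (rule comm_groupI)
  let ?Z = "rack_cocycles X (\<triangleright>)"
  show "\<one>\<^bsub>?Z\<^esub> \<in> carrier ?Z" by (auto simp: rack_cocycles_def closed)
  show "p \<otimes>\<^bsub>?Z\<^esub> q \<in> carrier ?Z" if "p \<in> carrier ?Z" "q \<in> carrier ?Z" for p q
  proof -
    have "p (x \<triangleright> y, x \<triangleright> z) * q (x \<triangleright> y, x \<triangleright> z) * (p (x, z) * q (x, z))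
        = p (x, y \<triangleright> z) * q (x, y \<triangleright> z) * (p (y, z) * q (y, z))"
      if "x \<in> X" "y \<in> X" "z \<in> X" for x y z
    proof -
      have eqs: "p (x \<triangleright> y, x \<triangleright> z) * p (x, z) = p (x, y \<triangleright> z) * p (y, z)"
        "q (x \<triangleright> y, x \<triangleright> z) * q (x, z) = q (x, y \<triangleright> z) * q (y, z)"
        using that \<open>p \<in> carrier ?Z\<close> \<open>q \<in> carrier ?Z\<close> by (simp_all add: rack_cocycles_def)
      show ?thesis using arg_cong2[where f = "(*)", OF eqs] by (simp only: mult_ac)
    qed
    then show ?thesis using that by (auto simp: rack_cocycles_def closed PiE_iff)
  qed
  show "p \<otimes>\<^bsub>?Z\<^esub> q \<otimes>\<^bsub>?Z\<^esub> r = p \<otimes>\<^bsub>?Z\<^esub> (q \<otimes>\<^bsub>?Z\<^esub> r)" for p q r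
    by (auto simp: rack_cocycles_def mult.assoc intro!: restrict_ext)
  show "p \<otimes>\<^bsub>?Z\<^esub> q = q \<otimes>\<^bsub>?Z\<^esub> p" for p q
    by (auto simp: rack_cocycles_def mult.commute intro!: restrict_ext)
  show "\<one>\<^bsub>?Z\<^esub> \<otimes>\<^bsub>?Z\<^esub> p = p" if "p \<in> carrier ?Z" for p
    using that by (auto simp: rack_cocycles_def PiE_iff extensional_def restrict_def)
  show "\<exists>q\<in>carrier ?Z. q \<otimes>\<^bsub>?Z\<^esub> p = \<one>\<^bsub>?Z\<^esub>" if "p \<in> carrier ?Z" for p
  proof (intro bexI[of _ "\<lambda>z\<in>X \<times> X. inverse (p z)"])
    show "(\<lambda>z\<in>X \<times> X. inverse (p z)) \<in> carrier ?Z"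
      using that by (auto simp: rack_cocycles_def closed PiE_iff
          simp flip: inverse_mult_distrib)
    show "(\<lambda>z\<in>X \<times> X. inverse (p z)) \<otimes>\<^bsub>?Z\<^esub> p = \<one>\<^bsub>?Z\<^esub>"
      using that by (auto simp: rack_cocycles_def PiE_iff intro!: restrict_ext)
  qed
qed

lemma cocycle_equiv_class:
  assumes "p \<in> carrier (rack_cocycles X (\<triangleright>))"
  shows "cocycle_equiv X (\<triangleright>) `` {p} =
    cocycle_equiv X (\<triangleright>) `` {\<one>\<^bsub>rack_cocycles X (\<triangleright>)\<^esub>} #>\<^bsub>rack_cocycles X (\<triangleright>)\<^esub> p"
    (is "?L = ?R")
proof -
  let ?Z = "rack_cocycles X (\<triangleright>)"
  interpret Z: comm_group ?Z by (rule rack_cocycles_comm_group)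
  have one: "\<one>\<^bsub>?Z\<^esub> = (\<lambda>z\<in>X \<times> X. 1)" by (simp add: rack_cocycles_def)
  have p0: "p (x, y) \<noteq> 0" if "x \<in> X" "y \<in> X" for x y
    using assms that by (auto simp: rack_cocycles_def)
  have ext: "q \<in> extensional (X \<times> X)" if "q \<in> carrier ?Z" for q
    using that by (auto simp: rack_cocycles_def PiE_iff)
  show ?thesis
  proof (intro subset_antisym subsetI)
    fix q assume "q \<in> ?L"
    then obtain \<gamma> where q: "q \<in> carrier ?Z" and \<gamma>: "\<gamma> \<in> X \<rightarrow> - {0}"
      and eq: "\<And>x y. x \<in> X \<Longrightarrow> y \<in> X \<Longrightarrow> q (x, y) = p (x, y) * \<gamma> (x \<triangleright> y) * inverse (\<gamma> y)"
      by (auto simp: cocycle_equiv_def)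
    define b where "b = q \<otimes>\<^bsub>?Z\<^esub> inv\<^bsub>?Z\<^esub> p"
    have b: "b \<in> carrier ?Z" and bp: "b \<otimes>\<^bsub>?Z\<^esub> p = q"
      using q assms by (auto simp: b_def Z.m_assoc)
    have "b (x, y) = \<gamma> (x \<triangleright> y) * inverse (\<gamma> y)" if "x \<in> X" "y \<in> X" for x y
    proof -
      have "b (x, y) * p (x, y) = q (x, y)"
        using that by (simp add: bp[symmetric] cocycle_mult_eq)
      also have "\<dots> = \<gamma> (x \<triangleright> y) * inverse (\<gamma> y) * p (x, y)"
        using eq[OF that] by (simp only: mult_ac)
      finally show ?thesis using p0[OF that] by (simp only: mult_cancel_right) simp
    qed
    then have "(\<one>\<^bsub>?Z\<^esub>, b) \<in> cocycle_equiv X (\<triangleright>)"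
      using b \<gamma> Z.one_closed by (auto simp: cocycle_equiv_def one intro!: bexI[of _ \<gamma>])
    then show "q \<in> ?R" using bp by (auto simp: r_coset_def)
  next
    fix q assume "q \<in> ?R"
    then obtain b \<gamma> where b: "b \<in> carrier ?Z" and \<gamma>: "\<gamma> \<in> X \<rightarrow> - {0}"
      and eq: "\<And>x y. x \<in> X \<Longrightarrow> y \<in> X \<Longrightarrow> b (x, y) = \<gamma> (x \<triangleright> y) * inverse (\<gamma> y)"
      and q: "q = b \<otimes>\<^bsub>?Z\<^esub> p"
      by (auto simp: r_coset_def cocycle_equiv_def one)
    have "q \<in> carrier ?Z" using b assms q by simp
    then show "q \<in> ?L" using assms \<gamma> eq
      by (auto simp: cocycle_equiv_def q cocycle_mult_eq intro!: bexI[of _ \<gamma>])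
  qed
qed

lemma rack_H2_eq_Mod:
  "rack_H2 X (\<triangleright>) = rack_cocycles X (\<triangleright>) Mod
     (cocycle_equiv X (\<triangleright>) `` {\<one>\<^bsub>rack_cocycles X (\<triangleright>)\<^esub>})"
proof -
  have "carrier (rack_cocycles X (\<triangleright>)) // cocycle_equiv X (\<triangleright>) =
    rcosets\<^bsub>rack_cocycles X (\<triangleright>)\<^esub>
      (cocycle_equiv X (\<triangleright>) `` {\<one>\<^bsub>rack_cocycles X (\<triangleright>)\<^esub>})"
    unfolding quotient_def RCOSETS_def
    by (rule SUP_cong[OF HOL.refl])
       (erule cocycle_equiv_class[THEN arg_cong[where f = "\<lambda>c. {c}"]])
  then show ?thesis by (simp add: rack_H2_def FactGroup_def)
qed

lemma coboundary_subgroup: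
  "subgroup (cocycle_equiv X (\<triangleright>) `` {\<one>\<^bsub>rack_cocycles X (\<triangleright>)\<^esub>}) (rack_cocycles X (\<triangleright>))"
  (is "subgroup ?B ?Z")
proof -
  interpret Z: comm_group ?Z by (rule rack_cocycles_comm_group)
  have one: "\<one>\<^bsub>?Z\<^esub> = (\<lambda>z\<in>X \<times> X. 1)" by (simp add: rack_cocycles_def)
  have memI: "b \<in> ?B" if "b \<in> carrier ?Z" "\<gamma> \<in> X \<rightarrow> - {0}"
    "\<And>x y. x \<in> X \<Longrightarrow> y \<in> X \<Longrightarrow> b (x, y) = \<gamma> (x \<triangleright> y) * inverse (\<gamma> y)" for b \<gamma>
    using that Z.one_closed by (auto simp: cocycle_equiv_def one intro!: bexI[of _ \<gamma>])
  have memE: "\<exists>\<gamma>\<in>X \<rightarrow> - {0}. \<forall>x\<in>X. \<forall>y\<in>X. b (x, y) = \<gamma> (x \<triangleright> y) * inverse (\<gamma> y)"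
    and mem: "b \<in> carrier ?Z" if "b \<in> ?B" for b
    using that by (auto simp: cocycle_equiv_def one)
  show ?thesis
  proof (rule Z.subgroupI)
    show "?B \<subseteq> carrier ?Z" using mem by blast
    show "?B \<noteq> {}" using memI[OF Z.one_closed, of "\<lambda>_. 1"] by (auto simp: one)
    fix a assume a: "a \<in> ?B"
    then obtain \<gamma> where \<gamma>: "\<gamma> \<in> X \<rightarrow> - {0}"
      "\<And>x y. x \<in> X \<Longrightarrow> y \<in> X \<Longrightarrow> a (x, y) = \<gamma> (x \<triangleright> y) * inverse (\<gamma> y)"
      using memE by blast
    have a': "a \<in> carrier ?Z" using mem a .
    show "inv\<^bsub>?Z\<^esub> a \<in> ?B"
    proof (rule memI[of _ "\<lambda>x. inverse (\<gamma> x)"])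
      show "(\<lambda>x. inverse (\<gamma> x)) \<in> X \<rightarrow> - {0}" using \<gamma>(1) by auto
      fix x y assume xy: "x \<in> X" "y \<in> X"
      have "(inv\<^bsub>?Z\<^esub> a \<otimes>\<^bsub>?Z\<^esub> a) (x, y) = 1" using a' xy by (simp add: one)
      then have "(inv\<^bsub>?Z\<^esub> a) (x, y) * a (x, y) = 1" using xy by (simp add: cocycle_mult_eq)
      then have "(inv\<^bsub>?Z\<^esub> a) (x, y) = inverse (a (x, y))"
        by (metis inverse_unique mult.commute)
      then show "(inv\<^bsub>?Z\<^esub> a) (x, y) = inverse (\<gamma> (x \<triangleright> y)) * inverse (inverse (\<gamma> y))"
        using \<gamma>(2)[OF xy] by simp
    qed (use a' in simp)
    fix b assume b: "b \<in> ?B"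
    then obtain \<delta> where \<delta>: "\<delta> \<in> X \<rightarrow> - {0}"
      "\<And>x y. x \<in> X \<Longrightarrow> y \<in> X \<Longrightarrow> b (x, y) = \<delta> (x \<triangleright> y) * inverse (\<delta> y)"
      using memE by blast
    show "a \<otimes>\<^bsub>?Z\<^esub> b \<in> ?B"
    proof (rule memI[of _ "\<lambda>x. \<gamma> x * \<delta> x"])
      show "(\<lambda>x. \<gamma> x * \<delta> x) \<in> X \<rightarrow> - {0}" using \<gamma>(1) \<delta>(1) by (auto simp: Pi_iff)
      show "a \<otimes>\<^bsub>?Z\<^esub> b \<in> carrier ?Z" using a' mem[OF b] by (rule Z.m_closed)
    qed (use \<gamma>(2) \<delta>(2) in \<open>simp add: cocycle_mult_eq\<close>)
  qed
qed

lemma rack_H2_comm_group: "comm_group (rack_H2 X (\<triangleright>))"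
  unfolding rack_H2_eq_Mod
  by (rule comm_group.abelian_FactGroup[OF rack_cocycles_comm_group coboundary_subgroup])

end

end

theory Submission
  imports Defs "HOL-Algebra.Zassenhaus"
begin

text \<open>
  Fix a base point \<open>e\<close> of \<open>X\<close>. Evaluating a cocycle \<open>q\<close> at \<open>(e, e)\<close> is a homomorphism to
  \<open>\<complex>\<^sup>\<times>\<close>; it kills coboundaries because \<open>e \<triangleright> e = e\<close>, and it is onto because constant functions are
  cocycles. The content of the theorem is that a cocycle with \<open>q (e, e) = 1\<close> is a coboundary.

  The cocycle identity says exactly that the maps \<open>(y, a) \<mapsto> (x \<triangleright> y, q (x, y) * a)\<close> satisfy the
  defining relations of \<open>G\<^sub>X\<close>, so \<open>G\<^sub>X\<close> acts on the set \<open>X \<times> \<complex>\<^sup>\<times>\<close> over its action on \<open>X\<close>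
  (\<open>fst_cocycle_action\<close>). If this action has an orbit meeting every fibre exactly once, then the
  orbit is the graph of a function \<open>\<gamma>\<close> with \<open>\<gamma> (x \<triangleright> y) = q (x, y) * \<gamma> y\<close>, which exhibits \<open>q\<close> as a coboundary.

  The orbit of \<open>(e, 1)\<close> is of this kind. Its stabilizer \<open>K\<close> contains the generator \<open>e\<close> of \<open>G\<^sub>X\<close>, as
  \<open>q (e, e) = 1\<close>. Since \<open>N\<^sub>X\<close> is transitive on \<open>X\<close>, every generator of \<open>G\<^sub>X\<close> is conjugate to \<open>e\<close> under
  \<open>N\<^sub>X\<close>, hence congruent to \<open>e\<close> modulo \<open>N\<^sub>X\<close>, and therefore \<open>G\<^sub>X = N\<^sub>X K\<close>
  (\<open>enveloping_group_factorization\<close>). So the orbit of \<open>(e, 1)\<close> is already its \<open>N\<^sub>X\<close>-orbit, and this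
  meets each fibre once because \<open>N\<^sub>X\<close> acts regularly on \<open>X\<close>.
\<close>


section \<open>Generators of the enveloping group\<close>

lemma presented_group_subgroup_eq:
  assumes "subgroup H (presented_group S R)"
    and gens: "\<And>s. s \<in> S \<Longrightarrow> word_rel S R `` {[(s, True)]} \<in> H"
  shows "H = carrier (presented_group S R)"
proof
  interpret G: group "presented_group S R" by (rule group_presented_group)
  interpret H: subgroup H "presented_group S R" by fact
  have one: "\<one>\<^bsub>presented_group S R\<^esub> = word_rel S R `` {[]}" by (simp add: presented_group_def)
  have letter: "word_rel S R `` {[(s, b)]} \<in> H" if s: "s \<in> S" for s b
  proof (cases b)
    case False
    have "word_rel S R `` {[(s, False)]} \<otimes>\<^bsub>presented_group S R\<^esub> word_rel S R `` {[(s, True)]}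
        = word_rel S R `` {[(s, False), (s, True)]}"
      using s by (simp add: presented_mult)
    also have "\<dots> = \<one>\<^bsub>presented_group S R\<^esub>"
      unfolding one using word_eq.cancel[OF s, of R False]
      by (intro equiv_class_eq[OF equiv_word_rel]) (simp add: word_rel_def)
    finally have "inv\<^bsub>presented_group S R\<^esub> (word_rel S R `` {[(s, True)]})
        = word_rel S R `` {[(s, False)]}"
      by (intro G.inv_equality) (use s in \<open>auto intro!: presented_carrierI\<close>)
    then show ?thesis using False H.m_inv_closed[OF gens[OF s]] by simp
  qed (use gens s in simp)
  have "word_rel S R `` {w} \<in> H" if "w \<in> lists (S \<times> UNIV)" for w
    using that
  proof (induction w)
    case Nil
    show ?case using H.one_closed by (simp add: one)
  next
    case (Cons l w)
    have "word_rel S R `` {[l]} \<otimes>\<^bsub>presented_group S R\<^esub> word_rel S R `` {w}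
        = word_rel S R `` {l # w}"
      using Cons.hyps by (subst presented_mult) auto
    moreover have "word_rel S R `` {[l]} \<in> H" using Cons.hyps letter by (cases l) auto
    ultimately show ?case using H.m_closed Cons.IH by metis
  qed
  then show "carrier (presented_group S R) \<subseteq> H" by (metis presented_carrierE subsetI)
qed (use assms(1) subgroup.subset in blast)

definition enveloping_generator :: "'a set \<Rightarrow> ('a \<Rightarrow> 'a \<Rightarrow> 'a) \<Rightarrow> 'a \<Rightarrow> 'a word set" where
  "enveloping_generator X rop x = word_rel X (enveloping_relations X rop) `` {[(x, True)]}"

lemma enveloping_generator_closed:
  "x \<in> X \<Longrightarrow> enveloping_generator X rop x \<in> carrier (enveloping_group X rop)"
  by (simp add: enveloping_generator_def enveloping_group_def presented_carrierI)

lemma enveloping_group_subgroup_eq: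
  assumes "subgroup H (enveloping_group X rop)"
    and "\<And>x. x \<in> X \<Longrightarrow> enveloping_generator X rop x \<in> H"
  shows "H = carrier (enveloping_group X rop)"
  using assms unfolding enveloping_group_def enveloping_generator_def
  by (rule presented_group_subgroup_eq)

lemma group_enveloping_group: "group (enveloping_group X rop)"
  by (simp add: enveloping_group_def group_presented_group)

lemma enveloping_derived_normal:
  "derived (enveloping_group X rop) (carrier (enveloping_group X rop)) \<lhd> enveloping_group X rop"
proof -
  interpret G: group "enveloping_group X rop" by (rule group_enveloping_group)
  have "carrier (enveloping_group X rop) \<lhd> enveloping_group X rop"
    by (intro G.normal_invI G.subgroup_self) simp
  then show ?thesis by (rule G.derived_is_normal)
qed

context rack
begin

abbreviation (input) "G \<equiv> enveloping_group X (\<triangleright>)"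
abbreviation (input) "gen \<equiv> enveloping_generator X (\<triangleright>)"
abbreviation (input) "act \<equiv> enveloping_action X (\<triangleright>)"
abbreviation (input) "N \<equiv> derived G (carrier G)"

lemma enveloping_generator_action: "x \<in> X \<Longrightarrow> y \<in> X \<Longrightarrow> act (gen x) y = x \<triangleright> y"
  using enveloping_action_generator[of x] by (simp add: enveloping_generator_def rack_map_def)

lemma enveloping_relation:
  assumes "x \<in> X" "y \<in> X"
  shows "gen x \<otimes>\<^bsub>G\<^esub> gen y = gen (x \<triangleright> y) \<otimes>\<^bsub>G\<^esub> gen x"
proof -
  let ?R = "enveloping_relations X (\<triangleright>)"
  have "word_eq X ?R [(x, True), (y, True)] [(x \<triangleright> y, True), (x, True)]"
    using assms closed[OF assms] by (intro word_eq.rel) (auto simp: enveloping_relations_def)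
  then have "word_rel X ?R `` {[(x, True), (y, True)]} = word_rel X ?R `` {[(x \<triangleright> y, True), (x, True)]}"
    by (intro equiv_class_eq[OF equiv_word_rel]) (simp add: word_rel_def)
  then show ?thesis
    using assms closed[OF assms]
    by (simp add: enveloping_group_def enveloping_generator_def presented_mult)
qed

text \<open>The action moves generators by conjugation. For a generator \<open>g\<close> this is the defining relation; the elements \<open>g\<close> for which it holds form a
  subgroup.\<close>

lemma enveloping_generator_conjugate:
  assumes "g \<in> carrier G" "x \<in> X"
  shows "gen (act g x) \<otimes>\<^bsub>G\<^esub> g = g \<otimes>\<^bsub>G\<^esub> gen x"
proof -
  interpret A: group_action G X act by (rule enveloping_group_action)
  interpret G: group G by (rule group_enveloping_group)
  note gen = enveloping_generator_closed[of _ X "(\<triangleright>)"]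
  let ?H = "{g \<in> carrier G. \<forall>x\<in>X. gen (act g x) \<otimes>\<^bsub>G\<^esub> g = g \<otimes>\<^bsub>G\<^esub> gen x}"
  have "subgroup ?H G"
  proof (rule G.subgroupI)
    have "\<one>\<^bsub>G\<^esub> \<in> ?H"
      using gen by (simp flip: A.id_eq_one)
    then show "?H \<noteq> {}" by blast
    fix g assume g: "g \<in> ?H"
    have "gen (act (inv\<^bsub>G\<^esub> g) x) \<otimes>\<^bsub>G\<^esub> inv\<^bsub>G\<^esub> g = inv\<^bsub>G\<^esub> g \<otimes>\<^bsub>G\<^esub> gen x" if x: "x \<in> X" for x
    proof -
      define y where "y = act (inv\<^bsub>G\<^esub> g) x"
      have y: "y \<in> X" unfolding y_def using g x A.element_image by blast
      have "act g y = x"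
        using A.orbit_sym_aux[of "inv\<^bsub>G\<^esub> g" x y] g x by (simp add: y_def)
      then have "gen x \<otimes>\<^bsub>G\<^esub> g = g \<otimes>\<^bsub>G\<^esub> gen y" using g y by auto
      then have "gen x = g \<otimes>\<^bsub>G\<^esub> (gen y \<otimes>\<^bsub>G\<^esub> inv\<^bsub>G\<^esub> g)"
        using g gen[OF x] gen[OF y] by (simp add: G.inv_solve_right flip: G.m_assoc)
      then have "gen y \<otimes>\<^bsub>G\<^esub> inv\<^bsub>G\<^esub> g = inv\<^bsub>G\<^esub> g \<otimes>\<^bsub>G\<^esub> gen x"
        using g gen[OF x] gen[OF y] by (simp add: G.inv_solve_left)
      then show ?thesis by (simp add: y_def)
    qed
    then show "inv\<^bsub>G\<^esub> g \<in> ?H" using g by simp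
    fix h assume h: "h \<in> ?H"
    have "gen (act (g \<otimes>\<^bsub>G\<^esub> h) x) \<otimes>\<^bsub>G\<^esub> (g \<otimes>\<^bsub>G\<^esub> h) = g \<otimes>\<^bsub>G\<^esub> h \<otimes>\<^bsub>G\<^esub> gen x" if x: "x \<in> X" for x
    proof -
      have hx: "act h x \<in> X" using h x A.element_image by blast
      have "gen (act g (act h x)) \<otimes>\<^bsub>G\<^esub> (g \<otimes>\<^bsub>G\<^esub> h) = gen (act g (act h x)) \<otimes>\<^bsub>G\<^esub> g \<otimes>\<^bsub>G\<^esub> h"
        using g h gen A.element_image[OF _ hx, of g] by (simp add: G.m_assoc)
      also have "\<dots> = g \<otimes>\<^bsub>G\<^esub> (gen (act h x) \<otimes>\<^bsub>G\<^esub> h)"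
        using g h hx gen[OF hx] by (simp add: G.m_assoc)
      also have "\<dots> = g \<otimes>\<^bsub>G\<^esub> h \<otimes>\<^bsub>G\<^esub> gen x" using g h x gen[OF x] by (simp add: G.m_assoc)
      finally show ?thesis using g h x by (simp add: A.composition_rule)
    qed
    then show "g \<otimes>\<^bsub>G\<^esub> h \<in> ?H" using g h by simp
  qed auto
  moreover have "gen x \<in> ?H" if "x \<in> X" for x
    using that gen enveloping_relation by (simp add: enveloping_generator_action)
  ultimately have "?H = carrier G" by (rule enveloping_group_subgroup_eq)
  then show ?thesis using assms by blast
qed

text \<open>Each generator of \<open>G\<close> is \<open>n e n\<inverse> = (n e n\<inverse> e\<inverse>) e\<close> for some \<open>n\<close> in \<open>N\<close>, and so lies in
  \<open>N K\<close>, which is a subgroup because \<open>N\<close> is normal.\<close>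

lemma enveloping_group_factorization:
  assumes e: "e \<in> X" and trans: "\<And>y. y \<in> X \<Longrightarrow> \<exists>n\<in>N. act n e = y"
    and K: "subgroup K G" "gen e \<in> K" and g: "g \<in> carrier G"
  shows "\<exists>n\<in>N. \<exists>k\<in>K. g = n \<otimes>\<^bsub>G\<^esub> k"
proof -
  interpret G: group G by (rule group_enveloping_group)
  interpret N: normal N G by (rule enveloping_derived_normal)
  note gen = enveloping_generator_closed[of _ X "(\<triangleright>)"]
  have "gen y \<in> N <#>\<^bsub>G\<^esub> K" if y: "y \<in> X" for y
  proof -
    obtain n where n: "n \<in> N" "act n e = y" using trans[OF y] by blast
    have nG: "n \<in> carrier G" using n(1) by (rule N.mem_carrier)
    define m where "m = n \<otimes>\<^bsub>G\<^esub> (gen e \<otimes>\<^bsub>G\<^esub> inv\<^bsub>G\<^esub> n \<otimes>\<^bsub>G\<^esub> inv\<^bsub>G\<^esub> gen e)"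
    have "m \<in> N" unfolding m_def
      using n gen[OF e] by (intro N.m_closed N.inv_op_closed2) auto
    have "gen y \<otimes>\<^bsub>G\<^esub> n = n \<otimes>\<^bsub>G\<^esub> gen e"
      using enveloping_generator_conjugate[OF nG e] n(2) by simp
    then have "gen y = n \<otimes>\<^bsub>G\<^esub> gen e \<otimes>\<^bsub>G\<^esub> inv\<^bsub>G\<^esub> n"
      using nG gen[OF e] gen[OF y] by (metis G.inv_solve_right G.m_closed)
    also have "\<dots> = m \<otimes>\<^bsub>G\<^esub> gen e"
      using nG gen[OF e] by (simp add: m_def G.m_assoc)
    finally show ?thesis using \<open>m \<in> N\<close> K(2) by (auto simp: set_mult_def)
  qed
  moreover have "subgroup (N <#>\<^bsub>G\<^esub> K) G"
    using G.mult_norm_subgroup[OF enveloping_derived_normal K(1)] .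
  ultimately have "N <#>\<^bsub>G\<^esub> K = carrier G" by (intro enveloping_group_subgroup_eq)
  then have "g \<in> N <#>\<^bsub>G\<^esub> K" using g by simp
  then show ?thesis by (auto simp: set_mult_def)
qed

end


section \<open>The action on a trivial bundle defined by a cocycle\<close>

definition cocycle_map ::
    "'a set \<Rightarrow> ('a \<Rightarrow> 'a \<Rightarrow> 'a) \<Rightarrow> ('a \<times> 'a \<Rightarrow> complex) \<Rightarrow> 'a \<Rightarrow> 'a \<times> complex \<Rightarrow> 'a \<times> complex" where
  "cocycle_map X rop q x = (\<lambda>p\<in>X \<times> - {0}. (rop x (fst p), q (x, fst p) * snd p))"

definition cocycle_action ::
    "'a set \<Rightarrow> ('a \<Rightarrow> 'a \<Rightarrow> 'a) \<Rightarrow> ('a \<times> 'a \<Rightarrow> complex) \<Rightarrow> 'a word set \<Rightarrow> 'a \<times> complex \<Rightarrow> 'a \<times> complex"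
  where "cocycle_action X rop q = induced_hom (BijGroup (X \<times> - {0})) (cocycle_map X rop q)"

context rack
begin

lemma cocycle_nonzero:
  "q \<in> carrier (rack_cocycles X (\<triangleright>)) \<Longrightarrow> x \<in> X \<Longrightarrow> y \<in> X \<Longrightarrow> q (x, y) \<noteq> 0"
  by (auto simp: rack_cocycles_def)

lemma cocycle_map_Bij:
  assumes q: "q \<in> carrier (rack_cocycles X (\<triangleright>))" and x: "x \<in> X"
  shows "cocycle_map X (\<triangleright>) q x \<in> carrier (BijGroup (X \<times> - {0}))"
proof -
  note q0 = cocycle_nonzero[OF q x]
  have inj: "y = z" if "x \<triangleright> y = x \<triangleright> z" "y \<in> X" "z \<in> X" for y z
    using bij[OF x] that by (auto simp: bij_betw_def inj_on_def)
  have "bij_betw (\<lambda>p. (x \<triangleright> fst p, q (x, fst p) * snd p)) (X \<times> - {0}) (X \<times> - {0})"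
    unfolding bij_betw_def
  proof (intro conjI subset_antisym subsetI)
    show "inj_on (\<lambda>p. (x \<triangleright> fst p, q (x, fst p) * snd p)) (X \<times> - {0})"
      using q0 inj by (fastforce simp: inj_on_def)
    fix p :: "'a \<times> complex" assume "p \<in> X \<times> - {0}"
    then obtain z a where p: "p = (z, a)" "z \<in> X" "a \<noteq> 0" by auto
    obtain y where y: "y \<in> X" "x \<triangleright> y = z" using bij[OF x] p(2) by (metis bij_betw_def imageE)
    show "p \<in> (\<lambda>p. (x \<triangleright> fst p, q (x, fst p) * snd p)) ` (X \<times> - {0})"
      using p y q0[OF y(1)] by (intro image_eqI[of _ _ "(y, a / q (x, y))"]) auto
  qed (use q0 x closed in auto)
  then show ?thesis
    by (auto simp: cocycle_map_def BijGroup_def Bij_def cong: bij_betw_cong)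
qed

text \<open>Both sides of the relation \<open>x y = (x \<triangleright> y) x\<close> send \<open>(z, a)\<close> to the same point of \<open>X\<close> by
  self-distributivity, and to the same scalar by the cocycle identity at \<open>(x, y, z)\<close>.\<close>

lemma cocycle_map_relation:
  assumes q: "q \<in> carrier (rack_cocycles X (\<triangleright>))"
  shows "\<forall>(u, v)\<in>enveloping_relations X (\<triangleright>).
     eval_word (BijGroup (X \<times> - {0})) (cocycle_map X (\<triangleright>) q) u
       = eval_word (BijGroup (X \<times> - {0})) (cocycle_map X (\<triangleright>) q) v"
proof clarify
  let ?B = "BijGroup (X \<times> - {0 :: complex})"
  let ?f = "cocycle_map X (\<triangleright>) q"
  fix u v assume uv: "(u, v) \<in> enveloping_relations X (\<triangleright>)"
  interpret B: group ?B by (rule group_BijGroup)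
  from uv obtain x y where xy: "x \<in> X" "y \<in> X"
    and u: "u = [(x, True), (y, True)]" and v: "v = [(x \<triangleright> y, True), (x, True)]"
    by (auto simp: enveloping_relations_def)
  note Bij = cocycle_map_Bij[OF q]
  have "compose (X \<times> - {0}) (?f x) (?f y) = compose (X \<times> - {0}) (?f (x \<triangleright> y)) (?f x)"
    unfolding compose_def
  proof (rule restrict_ext)
    fix p :: "'a \<times> complex" assume "p \<in> X \<times> - {0}"
    then obtain z a where p: "p = (z, a)" "z \<in> X" "a \<noteq> 0" by auto
    have "q (x, y \<triangleright> z) * (q (y, z) * a) = q (x \<triangleright> y, x \<triangleright> z) * (q (x, z) * a)"
      using q xy p(2) by (simp add: rack_cocycles_def flip: mult.assoc)
    then show "?f x (?f y p) = ?f (x \<triangleright> y) (?f x p)"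
      using p xy cocycle_nonzero[OF q]
      by (simp add: cocycle_map_def closed flip: self_distrib)
  qed
  then have "?f x \<otimes>\<^bsub>?B\<^esub> ?f y = ?f (x \<triangleright> y) \<otimes>\<^bsub>?B\<^esub> ?f x"
    using Bij[OF xy(1)] Bij[OF xy(2)] Bij[OF closed[OF xy]] by (simp add: BijGroup_def)
  then show "eval_word ?B ?f u = eval_word ?B ?f v"
    using Bij xy closed by (simp add: u v eval_word_def)
qed

lemma cocycle_action_group_action:
  assumes "q \<in> carrier (rack_cocycles X (\<triangleright>))"
  shows "group_action G (X \<times> - {0}) (cocycle_action X (\<triangleright>) q)"
  unfolding group_action_def group_hom_def group_hom_axioms_def
    enveloping_group_def cocycle_action_def
  using cocycle_map_Bij[OF assms]
  by (intro conjI group_presented_group group_BijGroup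
        induced_hom_hom[OF _ _ cocycle_map_relation[OF assms]]) auto

lemma cocycle_action_generator:
  assumes q: "q \<in> carrier (rack_cocycles X (\<triangleright>))" and "x \<in> X" "y \<in> X" "a \<noteq> 0"
  shows "cocycle_action X (\<triangleright>) q (gen x) (y, a) = (x \<triangleright> y, q (x, y) * a)"
proof -
  let ?B = "BijGroup (X \<times> - {0 :: complex})"
  interpret B: group ?B by (rule group_BijGroup)
  have "cocycle_action X (\<triangleright>) q (gen x) = eval_word ?B (cocycle_map X (\<triangleright>) q) [(x, True)]"
    unfolding cocycle_action_def enveloping_generator_def using assms cocycle_map_Bij[OF q]
    by (intro induced_hom_class[OF group_BijGroup _ cocycle_map_relation[OF q]]) auto
  also have "\<dots> = cocycle_map X (\<triangleright>) q x"
    using cocycle_map_Bij[OF q \<open>x \<in> X\<close>] by (simp add: eval_word_def)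
  finally show ?thesis using assms by (simp add: cocycle_map_def)
qed

text \<open>Equivariance of the projection to \<open>X\<close>: it holds for generators, and the elements \<open>g\<close> for which
  it holds form a subgroup.\<close>

lemma fst_cocycle_action:
  assumes q: "q \<in> carrier (rack_cocycles X (\<triangleright>))" and g: "g \<in> carrier G" and p: "p \<in> X \<times> - {0}"
  shows "fst (cocycle_action X (\<triangleright>) q g p) = act g (fst p)"
proof -
  interpret A: group_action G X act by (rule enveloping_group_action)
  interpret C: group_action G "X \<times> - {0}" "cocycle_action X (\<triangleright>) q"
    by (rule cocycle_action_group_action[OF q])
  interpret G: group G by (rule group_enveloping_group)
  let ?c = "cocycle_action X (\<triangleright>) q"
  let ?H = "{g \<in> carrier G. \<forall>p\<in>X \<times> - {0}. fst (?c g p) = act g (fst p)}"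
  have "subgroup ?H G"
  proof (rule G.subgroupI)
    have "\<one>\<^bsub>G\<^esub> \<in> ?H" by (auto simp flip: A.id_eq_one C.id_eq_one)
    then show "?H \<noteq> {}" by blast
    fix g assume g: "g \<in> ?H"
    have "fst (?c (inv\<^bsub>G\<^esub> g) p) = act (inv\<^bsub>G\<^esub> g) (fst p)" if p: "p \<in> X \<times> - {0}" for p
    proof -
      define r where "r = ?c (inv\<^bsub>G\<^esub> g) p"
      have r: "r \<in> X \<times> - {0}" unfolding r_def using g p C.element_image by blast
      have "?c g r = p"
        using C.orbit_sym_aux[of "inv\<^bsub>G\<^esub> g" p r] g p by (simp add: r_def)
      moreover have "fst (?c g r) = act g (fst r)" using g r by blast
      ultimately have "act g (fst r) = fst p" by simp
      then show ?thesis
        using A.orbit_sym_aux[of g "fst r" "fst p"] g r by (auto simp: r_def)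
    qed
    then show "inv\<^bsub>G\<^esub> g \<in> ?H" using g by simp
    fix h assume h: "h \<in> ?H"
    have "fst (?c (g \<otimes>\<^bsub>G\<^esub> h) p) = act (g \<otimes>\<^bsub>G\<^esub> h) (fst p)" if p: "p \<in> X \<times> - {0}" for p
    proof -
      have hp: "?c h p \<in> X \<times> - {0}" using h p C.element_image by blast
      have "\<forall>p\<in>X \<times> - {0}. fst (?c g p) = act g (fst p)" using g by blast
      then have "fst (?c g (?c h p)) = act g (fst (?c h p))" using hp by (rule bspec)
      moreover have "fst (?c h p) = act h (fst p)" using h p by blast
      moreover have "fst p \<in> X" using p by auto
      ultimately show ?thesis
        using g h p by (simp add: A.composition_rule C.composition_rule)
    qed
    then show "g \<otimes>\<^bsub>G\<^esub> h \<in> ?H" using g h by simp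
  qed auto
  moreover have "gen x \<in> ?H" if "x \<in> X" for x
    using that by (auto simp: enveloping_generator_closed enveloping_generator_action
        cocycle_action_generator[OF q])
  ultimately have "?H = carrier G" by (rule enveloping_group_subgroup_eq)
  then show ?thesis using g p by blast
qed

end


section \<open>Evaluation of cocycles at a base point\<close>

context quandle
begin

text \<open>Regularity gives a unique \<open>s y\<close> in \<open>N\<close> moving \<open>e\<close> to \<open>y\<close>. Moving \<open>(e, 1)\<close> by \<open>s y\<close> yields a point
  \<open>(y, \<gamma> y)\<close> over \<open>y\<close>, and the resulting section of the projection to \<open>X\<close> is invariant under the
  generators, because \<open>x (s y)\<close> and \<open>s (x \<triangleright> y)\<close> differ by an element fixing \<open>(e, 1)\<close>.\<close>

lemma cocycle_trivial_at_base_point_coboundary: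
  assumes regular: "regular_action (enveloping_derived X (\<triangleright>)) X act"
    and q: "q \<in> carrier (rack_cocycles X (\<triangleright>))" and e: "e \<in> X" and qe: "q (e, e) = 1"
  obtains \<gamma> where "\<gamma> \<in> X \<rightarrow> - {0}"
    and "\<And>x y. x \<in> X \<Longrightarrow> y \<in> X \<Longrightarrow> q (x, y) = \<gamma> (x \<triangleright> y) * inverse (\<gamma> y)"
proof -
  let ?c = "cocycle_action X (\<triangleright>) q"
  interpret A: group_action G X act by (rule enveloping_group_action)
  interpret C: group_action G "X \<times> - {0}" ?c by (rule cocycle_action_group_action[OF q])
  interpret G: group G by (rule group_enveloping_group)
  interpret N: normal N G by (rule enveloping_derived_normal)
  interpret T: transitive_action "enveloping_derived X (\<triangleright>)" X act
    using regular by (simp add: regular_action_def)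
  have trans: "\<exists>n\<in>N. act n e = y" if "y \<in> X" for y
    using T.unique_orbit[OF e that] by (simp add: enveloping_derived_def)
  have free: "n = \<one>\<^bsub>G\<^esub>" if "n \<in> N" "act n e = e" for n
    using regular e that
    by (auto simp: regular_action_def stabilizer_def enveloping_derived_def)
  have unique: "m = n" if m: "m \<in> N" and n: "n \<in> N" and eq: "act m e = act n e" for m n
  proof -
    have "act (inv\<^bsub>G\<^esub> n \<otimes>\<^bsub>G\<^esub> m) e = e"
      using A.orbit_sym_aux[of n e "act n e"] m n eq e by (simp add: A.composition_rule)
    then have "inv\<^bsub>G\<^esub> n \<otimes>\<^bsub>G\<^esub> m = \<one>\<^bsub>G\<^esub>" using m n by (intro free) auto
    then show ?thesis using m n by (metis G.inv_solve_left' G.r_one N.mem_carrier G.one_closed)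
  qed
  define s where "s y = (THE n. n \<in> N \<and> act n e = y)" for y
  have s: "s y \<in> N" "act (s y) e = y" if "y \<in> X" for y
  proof -
    have "\<exists>!n. n \<in> N \<and> act n e = y" using trans[OF that] unique by blast
    from theI'[OF this] show "s y \<in> N" "act (s y) e = y" by (auto simp: s_def)
  qed
  have base: "(e, 1) \<in> X \<times> - {0 :: complex}" using e by simp
  define \<gamma> where "\<gamma> y = snd (?c (s y) (e, 1))" for y
  have sec: "?c (s y) (e, 1) = (y, \<gamma> y)" if "y \<in> X" for y
    using fst_cocycle_action[OF q _ base, of "s y"] s[OF that] by (simp add: \<gamma>_def prod_eq_iff)
  have \<gamma>0: "\<gamma> y \<noteq> 0" if "y \<in> X" for y
    using C.element_image[OF _ base sec[OF that]] s[OF that] by auto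
  have K: "subgroup (stabilizer G ?c (e, 1)) G" using C.stabilizer_subgroup[OF base] .
  \<comment> \<open>The generator \<open>e\<close> maps \<open>(e, 1)\<close> to \<open>(e \<triangleright> e, q (e, e))\<close>, which is \<open>(e, 1)\<close> again.\<close>
  have Ke: "gen e \<in> stabilizer G ?c (e, 1)"
    using e qe by (simp add: stabilizer_def enveloping_generator_closed
        cocycle_action_generator[OF q] idem)
  have "q (x, y) = \<gamma> (x \<triangleright> y) * inverse (\<gamma> y)" if x: "x \<in> X" and y: "y \<in> X" for x y
  proof -
    note gx = enveloping_generator_closed[OF x, of "(\<triangleright>)"] and xy = closed[OF x y]
    have sG: "s y \<in> carrier G" using s[OF y] by simp
    obtain n k where n: "n \<in> N" and k: "k \<in> stabilizer G ?c (e, 1)"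
      and nk: "gen x \<otimes>\<^bsub>G\<^esub> s y = n \<otimes>\<^bsub>G\<^esub> k"
      using enveloping_group_factorization[OF e trans K Ke G.m_closed[OF gx sG]] by blast
    \<comment> \<open>Compute the image of \<open>(e, 1)\<close> under \<open>x (s y) = n k\<close> from each factorization; the comparison
      forces \<open>n = s (x \<triangleright> y)\<close>.\<close>
    have "(x \<triangleright> y, q (x, y) * \<gamma> y) = ?c (gen x \<otimes>\<^bsub>G\<^esub> s y) (e, 1)"
      using gx sG base x y \<gamma>0[OF y]
      by (simp add: C.composition_rule sec cocycle_action_generator[OF q])
    also have "\<dots> = ?c n (e, 1)"
      unfolding nk using n k base by (simp add: C.composition_rule stabilizer_def)
    finally have cn: "?c n (e, 1) = (x \<triangleright> y, q (x, y) * \<gamma> y)" ..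
    then have "act n e = x \<triangleright> y" using fst_cocycle_action[OF q _ base, of n] n by simp
    then have "n = s (x \<triangleright> y)" using s[OF xy] n by (intro unique) auto
    then have "\<gamma> (x \<triangleright> y) = q (x, y) * \<gamma> y" using cn sec[OF xy] by simp
    then show ?thesis using \<gamma>0[OF y] by simp
  qed
  then show ?thesis using that[of \<gamma>] \<gamma>0 by auto
qed

lemma cocycle_evaluation_hom:
  assumes "e \<in> X"
  shows "group_hom (rack_cocycles X (\<triangleright>)) complex_units (\<lambda>q. q (e, e))"
proof -
  interpret Z: comm_group "rack_cocycles X (\<triangleright>)" by (rule rack_cocycles_comm_group)
  interpret U: comm_group complex_units by (rule complex_units_comm_group)
  show ?thesis
    using assms by unfold_locales
      (auto simp: hom_def cocycle_mult_eq complex_units_def cocycle_nonzero)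
qed

lemma constant_cocycle:
  "c \<noteq> 0 \<Longrightarrow> (\<lambda>z\<in>X \<times> X. c) \<in> carrier (rack_cocycles X (\<triangleright>))"
  by (auto simp: rack_cocycles_def closed)

lemma cocycle_evaluation_kernel:
  assumes regular: "regular_action (enveloping_derived X (\<triangleright>)) X act" and e: "e \<in> X"
  shows "kernel (rack_cocycles X (\<triangleright>)) complex_units (\<lambda>q. q (e, e))
    = cocycle_equiv X (\<triangleright>) `` {\<one>\<^bsub>rack_cocycles X (\<triangleright>)\<^esub>}"
proof -
  interpret Z: comm_group "rack_cocycles X (\<triangleright>)" by (rule rack_cocycles_comm_group)
  have one: "\<one>\<^bsub>rack_cocycles X (\<triangleright>)\<^esub> = (\<lambda>z\<in>X \<times> X. 1)" by (simp add: rack_cocycles_def)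
  show ?thesis
  proof (intro subset_antisym subsetI)
    fix q assume "q \<in> kernel (rack_cocycles X (\<triangleright>)) complex_units (\<lambda>q. q (e, e))"
    then have q: "q \<in> carrier (rack_cocycles X (\<triangleright>))" "q (e, e) = 1"
      by (auto simp: kernel_def complex_units_def)
    obtain \<gamma> where "\<gamma> \<in> X \<rightarrow> - {0}"
      "\<And>x y. x \<in> X \<Longrightarrow> y \<in> X \<Longrightarrow> q (x, y) = \<gamma> (x \<triangleright> y) * inverse (\<gamma> y)"
      using cocycle_trivial_at_base_point_coboundary[OF regular q(1) e q(2)] by blast
    then show "q \<in> cocycle_equiv X (\<triangleright>) `` {\<one>\<^bsub>rack_cocycles X (\<triangleright>)\<^esub>}"
      using q Z.one_closed by (auto simp: cocycle_equiv_def one)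
  next
    fix q assume "q \<in> cocycle_equiv X (\<triangleright>) `` {\<one>\<^bsub>rack_cocycles X (\<triangleright>)\<^esub>}"
    then obtain \<gamma> where q: "q \<in> carrier (rack_cocycles X (\<triangleright>))" and \<gamma>: "\<gamma> \<in> X \<rightarrow> - {0}"
      and eq: "q (e, e) = \<gamma> (e \<triangleright> e) * inverse (\<gamma> e)"
      using e by (auto simp: cocycle_equiv_def one)
    have "\<gamma> e \<noteq> 0" using \<gamma> e by auto
    then have "q (e, e) = 1" using eq idem[OF e] by simp
    then show "q \<in> kernel (rack_cocycles X (\<triangleright>)) complex_units (\<lambda>q. q (e, e))"
      using q by (simp add: kernel_def complex_units_def)
  qed
qed

lemma rack_H2_iso_complex_units:
  assumes "regular_action (enveloping_derived X (\<triangleright>)) X act"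
  shows "rack_H2 X (\<triangleright>) \<cong> complex_units"
proof -
  obtain e where e: "e \<in> X" using nonempty by blast
  interpret ev: group_hom "rack_cocycles X (\<triangleright>)" complex_units "\<lambda>q. q (e, e)"
    by (rule cocycle_evaluation_hom[OF e])
  have "(\<lambda>q. q (e, e)) ` carrier (rack_cocycles X (\<triangleright>)) = carrier complex_units"
  proof (intro subset_antisym subsetI)
    fix c assume "c \<in> carrier complex_units"
    then show "c \<in> (\<lambda>q. q (e, e)) ` carrier (rack_cocycles X (\<triangleright>))"
      using e constant_cocycle[of c]
      by (intro image_eqI[of _ _ "\<lambda>z\<in>X \<times> X. c"]) (auto simp: complex_units_def)
  qed auto
  from ev.FactGroup_iso[OF this] show ?thesis
    by (simp add: rack_H2_eq_Mod cocycle_evaluation_kernel[OF assms e])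
qed

end

theorem corollary1p4:
  fixes X :: "'a set" and rop :: "'a \<Rightarrow> 'a \<Rightarrow> 'a"
  assumes "quandle X rop"
    and "finite X"
    and "indecomposable X rop"
    and "regular_action (enveloping_derived X rop) X (enveloping_action X rop)"
  shows "rack_H2 X rop \<cong> complex_units"
  using assms(1,4) by (rule quandle.rack_H2_iso_complex_units)

end
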